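(* Let $p$ be a prime, let $a$ be an integer with $a\equiv1\ (\mathrm{mod}\ p)$, and let $\alpha,n,r$ be integers with $\alpha\geq2$ and $n\geq p^{\alpha-1}$. Then $$\sum_{k\equiv r\ (\mathrm{mod}\ p^{\alpha})}\binom nk(-a)^k\equiv0\ \left(\mathrm{mod}\ p^{\left\lfloor\frac{n-p^{\alpha-1}}{\varphi(p^{\alpha})}\right\rfloor}\right).$$
   Context: $\varphi$ is Euler's totient function and $\lfloor\cdot\rfloor$ is the floor function. The sum runs over the integers $k$ with $0\leq k\leq n$ in the given residue class (for other integers $k$ one has $\binom nk=0$). *)

theory Defs
  imports "HOL-Number_Theory.Number_Theory"
begin

end

(* Put q = p^\<alpha> and N = p^(\<alpha>-1). The sums in question are the coefficients of (1 - a x)^n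
   in Z[x]/(x^q - 1). Write y = x^N and \<Phi> = 1 + y + ... + y^(p-1), so that (1 - y) \<Phi> = 0 and
   \<Phi>^2 = p \<Phi> in this ring, while (1 - a x)^N \<equiv> 1 - y and (1 - a x)^\<phi>(q) \<equiv> \<Phi> modulo p.
   Hence multiplication by T = (1 - a x)^\<phi>(q) gains a factor p on each of 1 - y, \<Phi> and p, and
   (1 - a x)^N T^m is divisible by p^m because (1 - a x)^N is a combination of 1 - y and p. *)
theory Submission
  imports Defs "HOL-Computational_Algebra.Polynomial_Factorial"
begin

text \<open>The inner binomial coefficients are divisible by \<open>p\<close>. Working with
  \<open>of_nat p\<close> in any commutative ring lets this apply to integer polynomials.\<close>

lemma prime_dvd_add_power_diff:
  fixes u v :: "'a :: comm_ring_1"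
  assumes "prime p"
  shows "of_nat p dvd (u + v) ^ p - (u ^ p + v ^ p)"
proof -
  have p: "0 < p" using assms by (simp add: prime_gt_0_nat)
  have "(u + v) ^ p = (\<Sum>k\<le>p. of_nat (p choose k) * u ^ k * v ^ (p - k))"
    by (rule binomial_ring)
  also have "{..p} = insert 0 (insert p {0<..<p})" using p by auto
  finally have "(u + v) ^ p - (u ^ p + v ^ p) = (\<Sum>k\<in>{0<..<p}. of_nat (p choose k) * u ^ k * v ^ (p - k))"
    using p by simp
  also have "of_nat p dvd \<dots>"
  proof (rule dvd_sum)
    fix k assume "k \<in> {0<..<p}"
    hence "p dvd p choose k" using assms by (intro dvd_choose_prime) auto
    hence "of_nat p dvd (of_nat (p choose k) :: 'a)" by (elim dvdE) simp
    thus "of_nat p dvd of_nat (p choose k) * u ^ k * v ^ (p - k)" by simp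
  qed
  finally show ?thesis .
qed

lemma dvd_power_diff:
  fixes u v :: "'a :: comm_ring_1"
  assumes "d dvd u - v"
  shows "d dvd u ^ n - v ^ n"
  using assms by (metis dvd_mult2 power_diff_sumr2)

lemma dvd_diff_trans:
  fixes u v w :: "'a :: comm_ring_1"
  assumes "d dvd u - v" and "d dvd v - w"
  shows "d dvd u - w"
  using dvd_add[OF assms] by simp

lemma prime_dvd_add_prime_power_diff:
  fixes u v :: "'a :: comm_ring_1"
  assumes "prime p"
  shows "of_nat p dvd (u + v) ^ (p ^ k) - (u ^ (p ^ k) + v ^ (p ^ k))"
proof (induction k)
  case (Suc k)
  let ?w = "u ^ (p ^ k) + v ^ (p ^ k)"
  have "of_nat p dvd ((u + v) ^ (p ^ k)) ^ p - ?w ^ p"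
    using Suc by (rule dvd_power_diff)
  moreover have "of_nat p dvd ?w ^ p - ((u ^ (p ^ k)) ^ p + (v ^ (p ^ k)) ^ p)"
    by (rule prime_dvd_add_power_diff[OF assms])
  ultimately have "of_nat p dvd ((u + v) ^ (p ^ k)) ^ p - ((u ^ (p ^ k)) ^ p + (v ^ (p ^ k)) ^ p)"
    by (rule dvd_diff_trans)
  thus ?case by (simp add: power_mult [symmetric] mult.commute)
qed simp

text \<open>Here \<open>g\<close> and \<open>h\<close> are arbitrary error terms, since the two
  factors will be known only modulo \<open>p\<close>. The quotient by \<open>1 - y ^ p\<close> is
  replaced by explicit multiples of \<open>D\<close>, and the factors \<open>P\<close> are gained by
  induction on the exponent.\<close>

lemma mult_power_divisible_mod:
  fixes y h g :: "'a :: comm_ring_1" and p :: nat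
  defines "\<Phi> \<equiv> (\<Sum>i<p. y ^ i)"
  defines "T \<equiv> \<Phi> + of_nat p * h"
  shows "\<exists>u. (1 - y ^ p) dvd (1 - y + of_nat p * g) * T ^ m - of_nat p ^ m * u"
proof -
  define D where "D = 1 - y ^ p"
  define P where "P = (of_nat p :: 'a)"
  have T: "T = \<Phi> + P * h" by (simp add: T_def P_def)
  have D: "D = (1 - y) * \<Phi>"
    unfolding D_def \<Phi>_def by (rule one_diff_power_eq)
  have "\<Phi> - P = (\<Sum>i<p. y ^ i - 1)"
    by (simp add: \<Phi>_def P_def sum_subtractf)
  also have "1 - y dvd \<dots>"
  proof (rule dvd_sum)
    fix i have "y - 1 dvd y ^ i - 1 ^ i" by (rule dvd_power_diff) simp
    thus "1 - y dvd y ^ i - 1" by (metis minus_dvd_iff minus_diff_eq power_one)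
  qed
  \<comment> \<open>Each \<open>y ^ i\<close> is 1 modulo \<open>1 - y\<close>, so \<Phi> is
    \<open>P\<close> there; multiplying by \<Phi> turns the factor \<open>1 - y\<close> into
    \<open>D\<close>.\<close>
  finally obtain c where c: "\<Phi> - P = (1 - y) * c" ..
  have sq: "\<Phi> * \<Phi> = P * \<Phi> + D * c"
  proof -
    have "\<Phi> * \<Phi> = P * \<Phi> + (\<Phi> - P) * \<Phi>" by (simp add: algebra_simps)
    also have "(\<Phi> - P) * \<Phi> = D * c" unfolding c D by (simp add: mult_ac)
    finally show ?thesis .
  qed
  have "\<exists>u w. (1 - y) * T ^ m = P ^ m * u + D * w"
  proof (induction m)
    case 0 show ?case by (rule exI[of _ "1 - y"], rule exI[of _ 0]) simp
  next
    case (Suc m)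
    then obtain u w where uw: "(1 - y) * T ^ m = P ^ m * u + D * w" by blast
    have "(1 - y) * T ^ Suc m = D * T ^ m + P * h * ((1 - y) * T ^ m)"
      by (simp add: T D algebra_simps)
    also have "\<dots> = P ^ Suc m * (u * h) + D * (T ^ m + P * h * w)"
      unfolding uw by (simp add: algebra_simps)
    finally have "(1 - y) * T ^ Suc m = P ^ Suc m * (u * h) + D * (T ^ m + P * h * w)" .
    thus ?case by blast
  qed
  then obtain u1 w1 where 1: "(1 - y) * T ^ m = P ^ m * u1 + D * w1" by blast
  \<comment> \<open>Needed for every exponent, because the next induction calls it at its own
    \<open>m\<close>.\<close>
  have 2: "\<exists>u w. \<Phi> * T ^ m = P ^ m * u + D * w" for m
  proof (induction m)
    case 0 show ?case by (rule exI[of _ \<Phi>], rule exI[of _ 0]) simp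
  next
    case (Suc m)
    then obtain u w where uw: "\<Phi> * T ^ m = P ^ m * u + D * w" by blast
    have "\<Phi> * T ^ Suc m = (\<Phi> * \<Phi>) * T ^ m + P * h * (\<Phi> * T ^ m)"
      by (simp add: T algebra_simps)
    also have "\<dots> = P * (1 + h) * (\<Phi> * T ^ m) + D * c * T ^ m"
      unfolding sq by (simp add: algebra_simps)
    finally have "\<Phi> * T ^ Suc m = P ^ Suc m * (u * (1 + h)) + D * (c * T ^ m + P * (1 + h) * w)"
      unfolding uw by (simp add: algebra_simps)
    thus ?case by blast
  qed
  have "\<exists>u w. P * T ^ m = P ^ m * u + D * w"
  proof (induction m)
    case 0 show ?case by (rule exI[of _ P], rule exI[of _ 0]) simp
  next
    case (Suc m)
    then obtain u w where uw: "P * T ^ m = P ^ m * u + D * w" by blast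
    obtain u' w' where uw': "\<Phi> * T ^ m = P ^ m * u' + D * w'" using 2 by blast
    \<comment> \<open>Splitting off one factor \<open>T = \<Phi> + P * h\<close>, both summands
      carry an additional \<open>P\<close>: the first by \<open>2\<close>, the second by the
      induction hypothesis.\<close>
    have "P * T ^ Suc m = P * (\<Phi> * T ^ m) + P * h * (P * T ^ m)"
      by (simp add: T algebra_simps)
    hence "P * T ^ Suc m = P ^ Suc m * (u' + h * u) + D * (P * w' + P * h * w)"
      unfolding uw uw' by (simp add: algebra_simps)
    thus ?case by blast
  qed
  then obtain u3 w3 where 3: "P * T ^ m = P ^ m * u3 + D * w3" by blast
  have "(1 - y + P * g) * T ^ m - P ^ m * (u1 + g * u3) = D * (w1 + g * w3)"
  proof -
    have "(1 - y + P * g) * T ^ m = (1 - y) * T ^ m + g * (P * T ^ m)"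
      by (simp add: algebra_simps)
    thus ?thesis unfolding 1 3 by (simp add: algebra_simps)
  qed
  thus ?thesis unfolding D_def P_def by (metis dvd_triv_left)
qed

text \<open>Multiplication by x^q shifts exponents by \<open>q\<close> and so stays inside the
  residue class; the degree bound ensures that the cutoff at \<open>M\<close> loses no term.\<close>

lemma sum_coeff_residue_class_monom_mult:
  fixes w :: "'a :: comm_ring_1 poly"
  assumes "degree w + q \<le> M"
  shows "(\<Sum>k | k \<le> M \<and> [int k = r] (mod int q). coeff (monom 1 q * w) k) =
         (\<Sum>k | k \<le> M \<and> [int k = r] (mod int q). coeff w k)"
proof -
  have "(\<Sum>k | k \<le> M \<and> [int k = r] (mod int q). coeff (monom 1 q * w) k) =
        (\<Sum>k | q \<le> k \<and> k \<le> M \<and> [int k = r] (mod int q). coeff w (k - q))"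
    by (rule sum.mono_neutral_cong_right) (auto simp: coeff_monom_mult)
  also have "\<dots> = (\<Sum>k | k \<le> M - q \<and> [int k = r] (mod int q). coeff w k)"
    by (rule sum.reindex_bij_witness[of _ "\<lambda>k. k + q" "\<lambda>k. k - q"])
       (use assms in \<open>auto simp: cong_def\<close>)
  also have "\<dots> = (\<Sum>k | k \<le> M \<and> [int k = r] (mod int q). coeff w k)"
    by (rule sum.mono_neutral_left) (use assms in \<open>auto dest!: le_degree\<close>)
  finally show ?thesis .
qed

text \<open>Summing coefficients over a residue class modulo \<open>q\<close> is additive and kills
  multiples of 1 - x^q, so only the part \<open>of_nat d * u\<close> contributes.\<close>

lemma sum_coeff_residue_class_dvd:
  fixes f u :: "int poly"
  assumes "(1 - monom 1 q) dvd f - of_nat d * u" and "degree f \<le> n"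
  shows "int d dvd (\<Sum>k | k \<le> n \<and> [int k = r] (mod int q). coeff f k)"
proof -
  obtain w where w: "f - of_nat d * u = (1 - monom 1 q) * w" using assms(1) ..
  \<comment> \<open>Large enough to contain all of \<open>f\<close> and of
    \<open>monom 1 q * w\<close>; terms of \<open>u\<close> beyond \<open>M\<close> do no
    harm.\<close>
  define M where "M = n + degree w + q"
  let ?A = "{k. k \<le> M \<and> [int k = r] (mod int q)}"
  have f: "f = of_nat d * u + w - monom 1 q * w" using w by (simp add: algebra_simps)
  have "(\<Sum>k | k \<le> n \<and> [int k = r] (mod int q). coeff f k) = (\<Sum>k\<in>?A. coeff f k)"
    by (rule sum.mono_neutral_left) (use assms(2) in \<open>auto simp: M_def dest!: le_degree\<close>)
  also have "\<dots> = int d * (\<Sum>k\<in>?A. coeff u k)"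
    using sum_coeff_residue_class_monom_mult[of w q M r]
    by (subst f) (simp add: M_def sum.distrib sum_subtractf sum_distrib_left of_nat_poly)
  finally show ?thesis by simp
qed

text \<open>Modulo \<open>p\<close>, (1 - y)^p equals 1 - y^p, which is 1 - y times the geometric
  sum. The factor 1 - y cancels because \<open>p\<close> is a prime element of the polynomial
  ring.\<close>

lemma prime_dvd_one_minus_power_diff_geometric:
  fixes y :: "int poly"
  assumes "prime p" and "\<not> of_nat p dvd 1 - y"
  shows "of_nat p dvd (1 - y) ^ (p - 1) - (\<Sum>i<p. y ^ i)"
proof -
  have "prime_elem (of_nat p :: int poly)"
    using assms(1) by (simp add: of_nat_poly lift_prime_elem_poly)
  moreover have "of_nat p dvd (1 - y) * ((1 - y) ^ (p - 1) - (\<Sum>i<p. y ^ i))"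
  proof -
    \<comment> \<open>Expanding 1 as (1 - y) + y avoids the sign (-1)^p, so p = 2 needs no separate
      case.\<close>
    have "of_nat p dvd ((1 - y) + y) ^ p - ((1 - y) ^ p + y ^ p)"
      by (rule prime_dvd_add_power_diff[OF assms(1)])
    hence "of_nat p dvd (1 - y ^ p) - (1 - y) ^ p"
      by (simp add: algebra_simps)
    also have "(1 - y) ^ p = (1 - y) * (1 - y) ^ (p - 1)"
      using prime_gt_0_nat[OF assms(1)] by (cases p) simp_all
    also have "1 - y ^ p = (1 - y) * (\<Sum>i<p. y ^ i)"
      by (rule one_diff_power_eq)
    finally have "of_nat p dvd - ((1 - y) * (\<Sum>i<p. y ^ i) - (1 - y) * (1 - y) ^ (p - 1))"
      by (simp only: dvd_minus_iff)
    thus ?thesis by (simp only: minus_diff_eq right_diff_distrib)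
  qed
  ultimately show ?thesis using assms(2) by (simp add: prime_elem_dvd_mult_iff)
qed

theorem mainTheorem5:
  fixes p \<alpha> n :: nat and a r :: int
  assumes "prime p"
    and "[a = 1] (mod int p)"
    and "\<alpha> \<ge> 2"
    and "n \<ge> p ^ (\<alpha> - 1)"
  shows "[(\<Sum>k | k \<le> n \<and> [int k = r] (mod (int p ^ \<alpha>)). int (n choose k) * (- a) ^ k) = 0]
    (mod (int p ^ nat \<lfloor>(real n - real (p ^ (\<alpha> - 1))) / real (totient (p ^ \<alpha>))\<rfloor>))"
proof -
  define N where "N = p ^ (\<alpha> - 1)"
  define m where "m = nat \<lfloor>(real n - real N) / real (totient (p ^ \<alpha>))\<rfloor>"
  define f where "f = [:1, - a:]"
  define x where "x = (monom 1 1 :: int poly)"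
  define y where "y = (monom 1 N :: int poly)"
  have "N > 0" using prime_gt_0_nat[OF assms(1)] by (simp add: N_def)
  have tot: "totient (p ^ \<alpha>) = N * (p - 1)"
    using assms(1,3) by (simp add: totient_prime_power N_def)
  have yp: "y ^ p = monom 1 (p ^ \<alpha>)"
    using assms(3) by (cases \<alpha>) (simp_all add: y_def monom_power N_def mult.commute)
  have xN: "x ^ N = y" by (simp add: x_def y_def monom_power)

  \<comment> \<open>As \<open>f\<close> is 1 - a x, this difference is (1 - a) x, which is where a
    \<equiv> 1 enters.\<close>
  have "f - (1 - x) = [:1 - a:] * x"
    by (simp add: f_def x_def monom_altdef one_pCons)
  moreover have "int p dvd 1 - a"
    using assms(2) by (simp add: cong_iff_dvd_diff dvd_diff_commute)
  ultimately have "of_nat p dvd f - (1 - x)"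
    by (simp add: of_nat_poly const_poly_dvd_iff)
  hence "of_nat p dvd f ^ N - (1 - x) ^ N" by (rule dvd_power_diff)
  moreover have "of_nat p dvd ((1 - x) + x) ^ N - ((1 - x) ^ N + x ^ N)"
    unfolding N_def by (rule prime_dvd_add_prime_power_diff[OF assms(1)])
  ultimately have "of_nat p dvd (f ^ N - (1 - x) ^ N) - (((1 - x) + x) ^ N - ((1 - x) ^ N + x ^ N))"
    by (rule dvd_diff)
  hence fN: "of_nat p dvd f ^ N - (1 - y)"
    by (simp add: xN algebra_simps)
  then obtain g where g: "f ^ N - (1 - y) = of_nat p * g" ..
  have "\<not> of_nat p dvd 1 - y"
  proof
    assume "of_nat p dvd 1 - y"
    \<comment> \<open>Since N > 0, the constant coefficient of \<open>1 - y\<close> is 1.\<close>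
    hence "int p dvd coeff (1 - y) 0" by (auto simp: of_nat_poly const_poly_dvd_iff dest!: spec[of _ 0])
    thus False using \<open>N > 0\<close> prime_gt_1_nat[OF assms(1)] by (simp add: y_def)
  qed
  hence "of_nat p dvd (1 - y) ^ (p - 1) - (\<Sum>i<p. y ^ i)"
    by (rule prime_dvd_one_minus_power_diff_geometric[OF assms(1)])
  with dvd_power_diff[OF fN] have "of_nat p dvd (f ^ N) ^ (p - 1) - (\<Sum>i<p. y ^ i)"
    by (rule dvd_diff_trans)
  then obtain h where h: "(f ^ N) ^ (p - 1) - (\<Sum>i<p. y ^ i) = of_nat p * h" ..

  \<comment> \<open>The bound n \<ge> N makes the quotient nonnegative, so \<open>nat\<close> does
    not alter the floor.\<close>
  have "real m \<le> (real n - real N) / real (totient (p ^ \<alpha>))"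
    using assms(4) by (auto simp: m_def N_def)
  hence "real m * real (totient (p ^ \<alpha>)) \<le> real n - real N"
    using prime_gt_0_nat[OF assms(1)] by (subst (asm) pos_le_divide_eq) auto
  moreover have "real (N + N * (p - 1) * m) = real N + real m * real (totient (p ^ \<alpha>))"
    unfolding tot by (simp only: of_nat_add of_nat_mult mult_ac)
  ultimately have "N + N * (p - 1) * m \<le> n" by linarith
  \<comment> \<open>The surplus exponent \<open>s\<close> only contributes a factor
    \<open>f ^ s\<close>, which preserves the divisibility.\<close>
  then obtain s where s: "n = N + N * (p - 1) * m + s" using le_Suc_ex by blast
  have fn: "f ^ n = f ^ N * ((f ^ N) ^ (p - 1)) ^ m * f ^ s"
    by (simp add: s power_add power_mult)
  have "f ^ N = 1 - y + of_nat p * g" "(f ^ N) ^ (p - 1) = (\<Sum>i<p. y ^ i) + of_nat p * h"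
    using g h by (simp_all add: algebra_simps)
  then obtain u where "(1 - y ^ p) dvd f ^ N * ((f ^ N) ^ (p - 1)) ^ m - of_nat p ^ m * u"
    using mult_power_divisible_mod[of y p g h m] by auto
  hence "(1 - y ^ p) dvd (f ^ N * ((f ^ N) ^ (p - 1)) ^ m - of_nat p ^ m * u) * f ^ s"
    by (rule dvd_mult2)
  hence "(1 - monom 1 (p ^ \<alpha>)) dvd f ^ n - of_nat (p ^ m) * (u * f ^ s)"
    by (simp add: yp fn algebra_simps)
  moreover have "degree (f ^ n) \<le> n"
    using degree_power_le[of f n] degree_pCons_le[of 1 "[:- a:]"]
    by (simp add: f_def split: if_splits)
  ultimately have "int (p ^ m) dvd (\<Sum>k | k \<le> n \<and> [int k = r] (mod int (p ^ \<alpha>)). coeff (f ^ n) k)"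
    by (rule sum_coeff_residue_class_dvd)
  also have "\<dots> = (\<Sum>k | k \<le> n \<and> [int k = r] (mod int (p ^ \<alpha>)). int (n choose k) * (- a) ^ k)"
    by (intro sum.cong) (auto simp: f_def coeff_linear_poly_power)
  finally show ?thesis
    by (simp add: cong_0_iff m_def N_def)
qed

end
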